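(* Let $\mathbb F$ be a field, $(G,+)$ an abelian group, $V$ an $\mathbb F$-vector space and $\sigma\colon G\times G\to\mathrm{Bil}(V\times V,V)$ a map such that the generalized group algebra $\mathfrak L=V^\sigma[G]$ is a Lie algebra. Let $\Gamma_{(V,\sigma,G)}$ be the $G$-grading on $\mathfrak L$ given by $\mathfrak L_g=Vg$ for $g\in G$. For any graded contraction $\varepsilon\colon G\times G\to\mathbb F$ of $\Gamma_{(V,\sigma,G)}$, the algebra $\mathfrak L^\varepsilon$ equals $V^{\varepsilon\sigma}[G]$ and is again a Lie algebra over $G$, where $\varepsilon\sigma\colon G\times G\to\mathrm{Bil}(V\times V,V)$ is the map $(g,h)\mapsto\varepsilon(g,h)\sigma_{g,h}$.
   Context: Generalized group algebra: for an abelian group $(G,+)$, an $\mathbb F$-vector space $V$ and a map $\sigma\colon G\times G\to\mathrm{Bil}(V\times V,V)$, $(g,h)\mapsto\sigma_{g,h}$ (with $\mathrm{Bil}(V\times V,V)$ the bilinear maps $V\times V\to V$), $V^\sigma[G]$ is the vector space of formal sums $\sum_{g\in G}r_g g$, $r_g\in V$ (finitely many nonzero; two are equal iff all coefficients agree), with product obtained by bilinear extension from $(rg)\cdot(sh)=\sigma_{g,h}(r,s)(g+h)$. If this product makes it a Lie algebra, $V^\sigma[G]$ is called a Lie algebra over $G$. A $G$-grading on an algebra $\mathcal A$ is a vector space decomposition $\mathcal A=\bigoplus_{g\in G}\mathcal A_g$ with $\mathcal A_g\mathcal A_h\subset\mathcal A_{g+h}$. Given a $G$-grading $\Gamma:\mathfrak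 L=\bigoplus_{g\in G}\mathfrak L_g$ on a Lie algebra over $\mathbb F$, a graded contraction of $\Gamma$ is a map $\varepsilon\colon G\times G\to\mathbb F$ such that the vector space $\mathfrak L$ endowed with the bilinear product determined by $[x,y]^\varepsilon:=\varepsilon(g,h)[x,y]$ for $x\in\mathfrak L_g$, $y\in\mathfrak L_h$, $g,h\in G$, is a Lie algebra; this Lie algebra is denoted $\mathfrak L^\varepsilon$. *)

theory Defs
  imports Complex_Main "HOL-Library.Poly_Mapping"
begin

text \<open>
  A vector space over a field \<open>'f\<close> is a type of class \<^class>\<open>ab_group_add\<close> together with a
  scalar multiplication \<open>s\<close> satisfying \<^const>\<open>vector_space\<close>. The formal sums with coefficients in
  \<open>'v\<close> and finite support in \<open>'g\<close> are the elements of \<open>'g \<Rightarrow>\<^sub>0 'v\<close>; the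
  library's convolution product on this type is not used. The prefix \<open>gga\<close> stands for
  generalized group algebra.
\<close>

definition bilinear_map ::
    "('f::field \<Rightarrow> 'v::ab_group_add \<Rightarrow> 'v) \<Rightarrow> ('v \<Rightarrow> 'v \<Rightarrow> 'v) \<Rightarrow> bool" where
  "bilinear_map s B \<longleftrightarrow>
     (\<forall>x. Vector_Spaces.linear s s (B x)) \<and> (\<forall>y. Vector_Spaces.linear s s (\<lambda>x. B x y))"

definition lie_algebra ::
    "('f::field \<Rightarrow> 'l::ab_group_add \<Rightarrow> 'l) \<Rightarrow> ('l \<Rightarrow> 'l \<Rightarrow> 'l) \<Rightarrow> bool" where
  "lie_algebra s br \<longleftrightarrow>
     vector_space s \<and> bilinear_map s br \<and>
     (\<forall>x. br x x = 0) \<and>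
     (\<forall>x y z. br x (br y z) + br y (br z x) + br z (br x y) = 0)"


definition gga_scale ::
    "('f::field \<Rightarrow> 'v::ab_group_add \<Rightarrow> 'v) \<Rightarrow> 'f \<Rightarrow> ('g \<Rightarrow>\<^sub>0 'v) \<Rightarrow> ('g \<Rightarrow>\<^sub>0 'v)" where
  "gga_scale s c = Poly_Mapping.map (s c)"

definition gga_mult ::
    "('g::ab_group_add \<Rightarrow> 'g \<Rightarrow> 'v \<Rightarrow> 'v \<Rightarrow> 'v::ab_group_add) \<Rightarrow>
      ('g \<Rightarrow>\<^sub>0 'v) \<Rightarrow> ('g \<Rightarrow>\<^sub>0 'v) \<Rightarrow> ('g \<Rightarrow>\<^sub>0 'v)" where
  "gga_mult \<sigma> x y =
     (\<Sum>g\<in>Poly_Mapping.keys x. \<Sum>h\<in>Poly_Mapping.keys y.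
        Poly_Mapping.single (g + h) (\<sigma> g h (Poly_Mapping.lookup x g) (Poly_Mapping.lookup y h)))"

definition lie_algebra_over ::
    "('f::field \<Rightarrow> 'v::ab_group_add \<Rightarrow> 'v) \<Rightarrow>
      ('g::ab_group_add \<Rightarrow> 'g \<Rightarrow> 'v \<Rightarrow> 'v \<Rightarrow> 'v) \<Rightarrow> bool" where
  "lie_algebra_over s \<sigma> \<longleftrightarrow>
     (\<forall>g h. bilinear_map s (\<sigma> g h)) \<and> lie_algebra (gga_scale s) (gga_mult \<sigma>)"

definition gga_component :: "'g \<Rightarrow> ('g \<Rightarrow>\<^sub>0 'v::zero) set" where
  "gga_component g = range (Poly_Mapping.single g)"


definition is_grading ::
    "('f::field \<Rightarrow> 'l::ab_group_add \<Rightarrow> 'l) \<Rightarrow> ('l \<Rightarrow> 'l \<Rightarrow> 'l) \<Rightarrow>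
      ('g::ab_group_add \<Rightarrow> 'l set) \<Rightarrow> bool" where
  "is_grading s m A \<longleftrightarrow>
     (\<forall>g. module.subspace s (A g)) \<and>
     (\<forall>x. \<exists>!d :: 'g \<Rightarrow>\<^sub>0 'l.
        (\<forall>g. Poly_Mapping.lookup d g \<in> A g) \<and>
        x = (\<Sum>g\<in>Poly_Mapping.keys d. Poly_Mapping.lookup d g)) \<and>
     (\<forall>g h. \<forall>x\<in>A g. \<forall>y\<in>A h. m x y \<in> A (g + h))"

text \<open>
  The bilinear product determined by \<open>[x,y]\<^sup>\<epsilon> = \<epsilon>(g,h)[x,y]\<close> on homogeneous elements; existence and
  uniqueness for a grading are shown in \<open>contracted_bracket_ex1\<close> below.
\<close>

definition contracted_bracket ::
    "('f::field \<Rightarrow> 'l::ab_group_add \<Rightarrow> 'l) \<Rightarrow> ('l \<Rightarrow> 'l \<Rightarrow> 'l) \<Rightarrow>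
      ('g::ab_group_add \<Rightarrow> 'l set) \<Rightarrow> ('g \<Rightarrow> 'g \<Rightarrow> 'f) \<Rightarrow> 'l \<Rightarrow> 'l \<Rightarrow> 'l" where
  "contracted_bracket s br A \<epsilon> =
     (THE b. bilinear_map s b \<and>
        (\<forall>g h. \<forall>x\<in>A g. \<forall>y\<in>A h. b x y = s (\<epsilon> g h) (br x y)))"

definition graded_contraction ::
    "('f::field \<Rightarrow> 'l::ab_group_add \<Rightarrow> 'l) \<Rightarrow> ('l \<Rightarrow> 'l \<Rightarrow> 'l) \<Rightarrow>
      ('g::ab_group_add \<Rightarrow> 'l set) \<Rightarrow> ('g \<Rightarrow> 'g \<Rightarrow> 'f) \<Rightarrow> bool" where
  "graded_contraction s br A \<epsilon> \<longleftrightarrow> lie_algebra s (contracted_bracket s br A \<epsilon>)"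

definition scaled_sigma ::
    "('f::field \<Rightarrow> 'v::ab_group_add \<Rightarrow> 'v) \<Rightarrow> ('g \<Rightarrow> 'g \<Rightarrow> 'f) \<Rightarrow>
      ('g \<Rightarrow> 'g \<Rightarrow> 'v \<Rightarrow> 'v \<Rightarrow> 'v) \<Rightarrow> ('g \<Rightarrow> 'g \<Rightarrow> 'v \<Rightarrow> 'v \<Rightarrow> 'v)" where
  "scaled_sigma s \<epsilon> \<sigma> = (\<lambda>g h x y. s (\<epsilon> g h) (\<sigma> g h x y))"


lemma sum_keys_superset:
  fixes d :: "'g \<Rightarrow>\<^sub>0 'l::zero" and f :: "'g \<Rightarrow> 'l \<Rightarrow> 'm::comm_monoid_add"
  assumes "\<And>g. f g 0 = 0" "finite S" "Poly_Mapping.keys d \<subseteq> S"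
  shows "(\<Sum>g\<in>Poly_Mapping.keys d. f g (Poly_Mapping.lookup d g)) =
         (\<Sum>g\<in>S. f g (Poly_Mapping.lookup d g))"
  by (rule sum.mono_neutral_left) (use assms in \<open>auto simp: in_keys_iff\<close>)

lemma contracted_bracket_ex1:
  fixes A :: "'g::ab_group_add \<Rightarrow> 'l::ab_group_add set"
  assumes vs: "vector_space s" and br: "bilinear_map s br" and gr: "is_grading s br A"
  shows "\<exists>!b. bilinear_map s b \<and>
           (\<forall>g h. \<forall>x\<in>A g. \<forall>y\<in>A h. b x y = s (\<epsilon> g h) (br x y))"
proof -
  interpret V: vector_space s by (rule vs)
  have sub: "V.subspace (A g)" for g using gr by (auto simp: is_grading_def)
  define P where "P x d \<longleftrightarrow> (\<forall>g. Poly_Mapping.lookup d g \<in> A g) \<and>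
      x = (\<Sum>g\<in>Poly_Mapping.keys d. Poly_Mapping.lookup d g)" for x d
  have ex1: "\<exists>!d. P x d" for x using gr unfolding is_grading_def P_def by blast
  define D where "D x = (THE d. P x d)" for x
  have PD: "P x (D x)" for x unfolding D_def by (rule theI'[OF ex1])
  note DP = PD[unfolded P_def]
  have Deq: "D x = d"
    if "\<And>g. Poly_Mapping.lookup d g \<in> A g"
      "x = (\<Sum>g\<in>Poly_Mapping.keys d. Poly_Mapping.lookup d g)" for x d
    using ex1[of x] PD[of x] that unfolding P_def by metis
  have D_add: "D (x + y) = D x + D y" for x y
  proof (rule Deq)
    fix g show "Poly_Mapping.lookup (D x + D y) g \<in> A g"
      using DP[of x] DP[of y] sub by (simp add: lookup_add V.subspace_add)
  next
    show "x + y = (\<Sum>g\<in>Poly_Mapping.keys (D x + D y). Poly_Mapping.lookup (D x + D y) g)"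
      using setsum_keys_plus_distrib[of "\<lambda>g x. x" "D x" "D y"] DP[of x] DP[of y] by simp
  qed
  let ?m = "\<lambda>c d. Poly_Mapping.map (s c) d"
  have lm: "Poly_Mapping.lookup (?m c d) g = s c (Poly_Mapping.lookup d g)" for c g
    and d :: "'g \<Rightarrow>\<^sub>0 'l"
    by (auto simp: Poly_Mapping.map.rep_eq when_def)
  have km: "Poly_Mapping.keys (?m c d) \<subseteq> Poly_Mapping.keys d" for c and d :: "'g \<Rightarrow>\<^sub>0 'l"
    by (auto simp: in_keys_iff lm)
  have sum_m: "(\<Sum>g\<in>Poly_Mapping.keys (?m c d). f g (Poly_Mapping.lookup (?m c d) g)) =
      s c (\<Sum>g\<in>Poly_Mapping.keys d. f g (Poly_Mapping.lookup d g))"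
    if "\<And>g. f g 0 = 0" "\<And>g c x. f g (s c x) = s c (f g x)"
    for c and d :: "'g \<Rightarrow>\<^sub>0 'l" and f :: "'g \<Rightarrow> 'l \<Rightarrow> 'l"
    using sum_keys_superset[of f "Poly_Mapping.keys d" "?m c d", OF that(1) _ km]
    by (simp add: lm that(2) V.scale_sum_right)
  have D_scale: "D (s c x) = ?m c (D x)" for c x
  proof (rule Deq)
    fix g show "Poly_Mapping.lookup (?m c (D x)) g \<in> A g"
      using DP[of x] sub by (simp add: lm V.subspace_scale)
  next
    show "s c x = (\<Sum>g\<in>Poly_Mapping.keys (?m c (D x)). Poly_Mapping.lookup (?m c (D x)) g)"
      using sum_m[of "\<lambda>g x. x" c "D x"] DP[of x] by simp
  qed
  have D_hom: "D x = Poly_Mapping.single g x" if "x \<in> A g" for x g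
    using that V.subspace_0[OF sub]
    by (intro Deq) (auto simp: lookup_single when_def)
  have lin: "Vector_Spaces.linear s s f \<longleftrightarrow>
      (\<forall>x y. f (x + y) = f x + f y) \<and> (\<forall>c x. f (s c x) = s c (f x))" for f
    using vs by (auto simp: module_hom_iff_linear[symmetric] module_hom_iff V.module_axioms)
  have bil: "bilinear_map s b \<longleftrightarrow>
      (\<forall>x y z. b x (y + z) = b x y + b x z) \<and> (\<forall>c x y. b x (s c y) = s c (b x y)) \<and>
      (\<forall>x y z. b (x + y) z = b x z + b y z) \<and> (\<forall>c x y. b (s c x) y = s c (b x y))" for b
    unfolding bilinear_map_def lin by auto
  have zero: "b x 0 = 0" "b 0 x = 0" if "bilinear_map s b" for b x
    using that unfolding bil by (metis V.scale_zero_left)+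
  note br' = br[unfolded bil] zero[OF br]
  define E where "E x y = (\<Sum>g\<in>Poly_Mapping.keys (D x). \<Sum>h\<in>Poly_Mapping.keys (D y).
      s (\<epsilon> g h) (br (Poly_Mapping.lookup (D x) g) (Poly_Mapping.lookup (D y) h)))" for x y
  have E_bil: "bilinear_map s E"
    unfolding bil
  proof (intro conjI allI)
    fix x y z c
    show "E x (y + z) = E x y + E x z"
      unfolding E_def D_add
      by (subst setsum_keys_plus_distrib) (auto simp: br' V.scale_right_distrib sum.distrib)
    show "E x (s c y) = s c (E x y)"
      unfolding E_def D_scale
      by (subst sum_m) (auto simp: br' V.scale_sum_right mult.commute)
    show "E (x + y) z = E x z + E y z"
      unfolding E_def D_add
      by (subst setsum_keys_plus_distrib) (auto simp: br' V.scale_right_distrib sum.distrib)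
    show "E (s c x) y = s c (E x y)"
      unfolding E_def D_scale
      by (subst sum_m[of "\<lambda>g u. \<Sum>h\<in>Poly_Mapping.keys (D y).
            s (\<epsilon> g h) (br u (Poly_Mapping.lookup (D y) h))"])
         (auto simp: br' V.scale_sum_right mult.commute)
  qed
  have E_hom: "E x y = s (\<epsilon> g h) (br x y)" if "x \<in> A g" "y \<in> A h" for x y g h
    using that by (simp add: E_def D_hom br')
  have uniq: "b = E" if b: "bilinear_map s b"
    "\<forall>g h. \<forall>x\<in>A g. \<forall>y\<in>A h. b x y = s (\<epsilon> g h) (br x y)" for b
  proof (intro ext)
    fix x y
    have sl: "b (sum f S) z = (\<Sum>i\<in>S. b (f i) z)" if "finite S" for f :: "'g \<Rightarrow> 'l" and S z
      using that b(1) zero[OF b(1)] unfolding bil by (induction S) auto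
    have sr: "b z (sum f S) = (\<Sum>i\<in>S. b z (f i))" if "finite S" for f :: "'g \<Rightarrow> 'l" and S z
      using that b(1) zero[OF b(1)] unfolding bil by (induction S) auto
    have "b x y = b (\<Sum>g\<in>Poly_Mapping.keys (D x). Poly_Mapping.lookup (D x) g)
                    (\<Sum>h\<in>Poly_Mapping.keys (D y). Poly_Mapping.lookup (D y) h)"
      using DP[of x] DP[of y] by simp
    also have "\<dots> = (\<Sum>g\<in>Poly_Mapping.keys (D x). \<Sum>h\<in>Poly_Mapping.keys (D y).
        b (Poly_Mapping.lookup (D x) g) (Poly_Mapping.lookup (D y) h))"
      by (subst sl) (simp_all add: sr)
    also have "\<dots> = E x y"
      unfolding E_def by (intro sum.cong refl b(2)[rule_format] DP[THEN conjunct1, rule_format])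
    finally show "b x y = E x y" .
  qed
  show ?thesis
  proof (rule ex1I[of _ E], intro conjI allI ballI)
    show "bilinear_map s E" by (rule E_bil)
    show "E x y = s (\<epsilon> g h) (br x y)" if "x \<in> A g" "y \<in> A h" for g h x y
      using that by (rule E_hom)
    show "b = E" if "bilinear_map s b \<and>
        (\<forall>g h. \<forall>x\<in>A g. \<forall>y\<in>A h. b x y = s (\<epsilon> g h) (br x y))" for b
      by (rule uniq[OF conjunct1[OF that] conjunct2[OF that]])
  qed
qed

end

theory Submission
  imports Defs
begin

text \<open>The contracted bracket is by definition the unique bilinear product that equals
  \<epsilon>(g,h)[x,y] on homogeneous x, y of degrees g, h. The product of
  \<open>scaled_sigma\<close> is such a product: it is bilinear
  (\<open>bilinear_map_gga_mult\<close>), and on monomials both it and the scaled bracket give the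
  monomial at g + h with coefficient \<epsilon>(g,h)\<sigma>(g,h)(v,w)
  (\<open>gga_mult_single\<close>). Hence the two coincide
  (\<open>contracted_bracket_gga_mult\<close>). Uniqueness is available because the monomial
  components form a grading (\<open>is_grading_gga_component\<close>): products of monomials land in
  the right degree, and a formal sum determines its homogeneous parts
  (\<open>lookup_sum_gga_components\<close>). Once the brackets are identified, the Lie axioms for
  the new product are exactly the assumption that \<epsilon> is a graded contraction.\<close>

lemma lookup_gga_scale:
  assumes "vector_space s"
  shows "Poly_Mapping.lookup (gga_scale s c x) g = s c (Poly_Mapping.lookup x g)"
proof -
  interpret vector_space s by (rule assms)
  show ?thesis by (auto simp: gga_scale_def Poly_Mapping.map.rep_eq when_def)
qed

lemma gga_scale_single:
  assumes "vector_space s"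
  shows "gga_scale s c (Poly_Mapping.single g v) = Poly_Mapping.single g (s c v)"
proof -
  interpret vector_space s by (rule assms)
  show ?thesis
    by (intro poly_mapping_eqI) (auto simp: lookup_gga_scale[OF assms] lookup_single when_def)
qed

lemma vector_space_gga_scale:
  assumes "vector_space s"
  shows "vector_space (gga_scale s)"
proof -
  interpret vector_space s by (rule assms)
  show ?thesis
    by unfold_locales
      (auto intro!: poly_mapping_eqI
        simp: lookup_gga_scale[OF assms] lookup_add scale_right_distrib scale_left_distrib)
qed

lemma bilinear_map_iff:
  assumes "vector_space s"
  shows "bilinear_map s b \<longleftrightarrow>
      (\<forall>x y z. b x (y + z) = b x y + b x z) \<and> (\<forall>c x y. b x (s c y) = s c (b x y)) \<and>
      (\<forall>x y z. b (x + y) z = b x z + b y z) \<and> (\<forall>c x y. b (s c x) y = s c (b x y))"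
proof -
  interpret V: vector_space s by (rule assms)
  have "Vector_Spaces.linear s s f \<longleftrightarrow>
      (\<forall>x y. f (x + y) = f x + f y) \<and> (\<forall>c x. f (s c x) = s c (f x))" for f
    using assms by (auto simp: module_hom_iff_linear[symmetric] module_hom_iff V.module_axioms)
  then show ?thesis unfolding bilinear_map_def by auto
qed

lemma bilinear_map_zero:
  assumes "bilinear_map s b"
  shows "b x 0 = 0" "b 0 x = 0"
proof -
  have "module_hom s s (b x)" "module_hom s s (\<lambda>y. b y x)"
    using assms by (auto simp: bilinear_map_def module_hom_iff_linear)
  then show "b x 0 = 0" "b 0 x = 0"
    using module_hom.zero by blast+
qed

text \<open>A monomial with coefficient 0 has empty support, so the defining double sum is then
  empty; bilinearity makes the right-hand side vanish as well.\<close>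

lemma gga_mult_single:
  assumes "bilinear_map s (\<sigma> g h)"
  shows "gga_mult \<sigma> (Poly_Mapping.single g v) (Poly_Mapping.single h w) =
    Poly_Mapping.single (g + h) (\<sigma> g h v w)"
  using bilinear_map_zero[OF assms] by (auto simp: gga_mult_def)

text \<open>The double sum ranges over supports, which may shrink under addition (cancellation) or
  scaling (by 0). Its summand vanishes at coefficient 0, so the sums can be taken over larger finite
  sets, where linearity is inherited from each \<sigma>(g,h).\<close>

lemma bilinear_map_gga_mult:
  fixes s :: "'f::field \<Rightarrow> 'v::ab_group_add \<Rightarrow> 'v"
    and \<sigma> :: "'g::ab_group_add \<Rightarrow> 'g \<Rightarrow> 'v \<Rightarrow> 'v \<Rightarrow> 'v"
  assumes vs: "vector_space s" and bil: "\<And>g h. bilinear_map s (\<sigma> g h)"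
  shows "bilinear_map (gga_scale s) (gga_mult \<sigma>)"
proof -
  interpret W: vector_space "gga_scale s :: _ \<Rightarrow> ('g \<Rightarrow>\<^sub>0 'v) \<Rightarrow> _"
    by (rule vector_space_gga_scale[OF vs])
  note lin = bil[unfolded bilinear_map_iff[OF vs]] bilinear_map_zero[OF bil]
  have scale_keys:
    "(\<Sum>g\<in>Poly_Mapping.keys (gga_scale s c x). f g (Poly_Mapping.lookup (gga_scale s c x) g)) =
      (\<Sum>g\<in>Poly_Mapping.keys x. f g (s c (Poly_Mapping.lookup x g)))"
    if "\<And>g. f g 0 = 0" for f :: "'g \<Rightarrow> 'v \<Rightarrow> 'g \<Rightarrow>\<^sub>0 'v" and c x
  proof -
    interpret vector_space s by (rule vs)
    have "Poly_Mapping.keys (gga_scale s c x) \<subseteq> Poly_Mapping.keys x"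
      by (auto simp: in_keys_iff lookup_gga_scale[OF vs])
    then show ?thesis
      using sum_keys_superset[of f "Poly_Mapping.keys x" "gga_scale s c x"] that
      by (simp add: lookup_gga_scale[OF vs])
  qed
  show ?thesis
    unfolding bilinear_map_iff[OF vector_space_gga_scale[OF vs]]
  proof (intro conjI allI)
    fix x y z :: "'g \<Rightarrow>\<^sub>0 'v" and c
    show "gga_mult \<sigma> x (y + z) = gga_mult \<sigma> x y + gga_mult \<sigma> x z"
      unfolding gga_mult_def
      by (subst setsum_keys_plus_distrib) (auto simp: lin single_add sum.distrib)
    show "gga_mult \<sigma> (x + y) z = gga_mult \<sigma> x z + gga_mult \<sigma> y z"
      unfolding gga_mult_def
      by (subst setsum_keys_plus_distrib) (auto simp: lin single_add sum.distrib)
    show "gga_mult \<sigma> x (gga_scale s c y) = gga_scale s c (gga_mult \<sigma> x y)"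
      unfolding gga_mult_def
      by (subst scale_keys) (auto simp: lin W.scale_sum_right gga_scale_single[OF vs])
    show "gga_mult \<sigma> (gga_scale s c x) y = gga_scale s c (gga_mult \<sigma> x y)"
      unfolding gga_mult_def
      \<comment> \<open>Here the summand over the left support is itself the inner sum over
        \<open>y\<close>, viewed as a function of the left coefficient.\<close>
      by (subst scale_keys[where f = "\<lambda>g v. \<Sum>h\<in>Poly_Mapping.keys y.
            Poly_Mapping.single (g + h) (\<sigma> g h v (Poly_Mapping.lookup y h))"])
        (auto simp: lin W.scale_sum_right gga_scale_single[OF vs])
  qed
qed

text \<open>The summand of degree g is supported at g alone, so only the one of degree h contributes
  at h. This is what makes the sum of components direct.\<close>

lemma lookup_sum_gga_components:
  fixes d :: "'g \<Rightarrow>\<^sub>0 'g \<Rightarrow>\<^sub>0 'v::ab_group_add"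
  assumes "\<And>g. Poly_Mapping.lookup d g \<in> gga_component g"
  shows "Poly_Mapping.lookup (\<Sum>g\<in>Poly_Mapping.keys d. Poly_Mapping.lookup d g) h =
    Poly_Mapping.lookup (Poly_Mapping.lookup d h) h"
proof -
  have off: "Poly_Mapping.lookup (Poly_Mapping.lookup d g) h = 0" if "g \<noteq> h" for g
    using assms[of g] that by (auto simp: gga_component_def lookup_single)
  have "Poly_Mapping.lookup (\<Sum>g\<in>Poly_Mapping.keys d. Poly_Mapping.lookup d g) h =
    (\<Sum>g\<in>Poly_Mapping.keys d. if g = h then Poly_Mapping.lookup (Poly_Mapping.lookup d h) h else 0)"
    unfolding lookup_sum by (intro sum.cong) (auto simp: off)
  \<comment> \<open>If h is not a key of \<open>d\<close>, the component there is 0 and both sides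
    vanish.\<close>
  then show ?thesis by (auto simp: sum.delta in_keys_iff)
qed

lemma is_grading_gga_component:
  fixes s :: "'f::field \<Rightarrow> 'v::ab_group_add \<Rightarrow> 'v"
    and \<sigma> :: "'g::ab_group_add \<Rightarrow> 'g \<Rightarrow> 'v \<Rightarrow> 'v \<Rightarrow> 'v"
  assumes vs: "vector_space s" and bil: "\<And>g h. bilinear_map s (\<sigma> g h)"
  shows "is_grading (gga_scale s) (gga_mult \<sigma>) gga_component"
  unfolding is_grading_def
proof (intro conjI allI ballI)
  fix g :: 'g
  interpret W: vector_space "gga_scale s :: _ \<Rightarrow> ('g \<Rightarrow>\<^sub>0 'v) \<Rightarrow> _"
    by (rule vector_space_gga_scale[OF vs])
  show "W.subspace (gga_component g)"
    unfolding W.subspace_def gga_component_def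
    by (auto simp: gga_scale_single[OF vs] single_add[symmetric]) (metis rangeI single_zero)
next
  fix x :: "'g \<Rightarrow>\<^sub>0 'v"
  \<comment> \<open>The decomposition of \<open>x\<close> into its monomials: \<open>d\<close> sends
    each g to the g-th term of \<open>x\<close>.\<close>
  define d where "d = Poly_Mapping.mapp Poly_Mapping.single x"
  have d: "Poly_Mapping.lookup d g = Poly_Mapping.single g (Poly_Mapping.lookup x g)" for g
    by (auto simp: d_def mapp.rep_eq when_def in_keys_iff)
  have d_comp: "Poly_Mapping.lookup d g \<in> gga_component g" for g
    by (simp add: d gga_component_def)
  show "\<exists>!d :: 'g \<Rightarrow>\<^sub>0 'g \<Rightarrow>\<^sub>0 'v. (\<forall>g. Poly_Mapping.lookup d g \<in> gga_component g) \<and>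
      x = (\<Sum>g\<in>Poly_Mapping.keys d. Poly_Mapping.lookup d g)"
  proof (rule ex1I[of _ d], intro conjI allI d_comp)
    show "x = (\<Sum>g\<in>Poly_Mapping.keys d. Poly_Mapping.lookup d g)"
      by (rule poly_mapping_eqI) (simp only: lookup_sum_gga_components[OF d_comp], simp add: d)
  next
    fix e :: "'g \<Rightarrow>\<^sub>0 'g \<Rightarrow>\<^sub>0 'v"
    assume e: "(\<forall>g. Poly_Mapping.lookup e g \<in> gga_component g) \<and>
      x = (\<Sum>g\<in>Poly_Mapping.keys e. Poly_Mapping.lookup e g)"
    show "e = d"
    proof (rule poly_mapping_eqI)
      fix g
      \<comment> \<open>The part of \<open>e\<close> in degree g is a monomial at g, so its
        coefficient, now read off from \<open>x\<close>, determines it.\<close>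
      have "Poly_Mapping.lookup x g = Poly_Mapping.lookup (Poly_Mapping.lookup e g) g"
        using e lookup_sum_gga_components[of e g] by simp
      moreover obtain v where "Poly_Mapping.lookup e g = Poly_Mapping.single g v"
        using e by (auto simp: gga_component_def)
      ultimately show "Poly_Mapping.lookup e g = Poly_Mapping.lookup d g"
        by (simp add: d)
    qed
  qed
next
  fix g h and x y :: "'g \<Rightarrow>\<^sub>0 'v"
  assume "x \<in> gga_component g" "y \<in> gga_component h"
  then show "gga_mult \<sigma> x y \<in> gga_component (g + h)"
    by (auto simp: gga_component_def gga_mult_single[OF bil])
qed

text \<open>Scalars commute in a field, so the factor \<epsilon>(g,h) passes through scaling in
  either argument.\<close>

lemma bilinear_map_scaled_sigma:
  assumes vs: "vector_space s" and bil: "\<And>g h. bilinear_map s (\<sigma> g h)"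
  shows "bilinear_map s (scaled_sigma s \<epsilon> \<sigma> g h)"
proof -
  interpret vector_space s by (rule vs)
  show ?thesis
    using bil[of g h]
    by (simp add: bilinear_map_iff[OF vs] scaled_sigma_def scale_right_distrib mult.commute)
qed

text \<open>By \<open>contracted_bracket_ex1\<close> the description defining the bracket has
  exactly one solution, so it suffices that the product of \<open>scaled_sigma\<close> satisfies it;
  homogeneous elements are monomials, where this is a direct computation.\<close>

lemma contracted_bracket_gga_mult:
  fixes s :: "'f::field \<Rightarrow> 'v::ab_group_add \<Rightarrow> 'v"
    and \<sigma> :: "'g::ab_group_add \<Rightarrow> 'g \<Rightarrow> 'v \<Rightarrow> 'v \<Rightarrow> 'v"
  assumes vs: "vector_space s" and bil: "\<And>g h. bilinear_map s (\<sigma> g h)"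
  shows "contracted_bracket (gga_scale s) (gga_mult \<sigma>) gga_component \<epsilon> =
    gga_mult (scaled_sigma s \<epsilon> \<sigma>)"
  unfolding contracted_bracket_def
proof (rule the1_equality[OF contracted_bracket_ex1])
  show "vector_space (gga_scale s :: _ \<Rightarrow> ('g \<Rightarrow>\<^sub>0 'v) \<Rightarrow> _)"
    by (rule vector_space_gga_scale[OF vs])
  show "bilinear_map (gga_scale s) (gga_mult \<sigma>)"
    by (rule bilinear_map_gga_mult[OF vs bil])
  show "is_grading (gga_scale s) (gga_mult \<sigma>) gga_component"
    by (rule is_grading_gga_component[OF vs bil])
  have bil': "bilinear_map s (scaled_sigma s \<epsilon> \<sigma> g h)" for g h
    by (rule bilinear_map_scaled_sigma[OF vs bil])
  show "bilinear_map (gga_scale s) (gga_mult (scaled_sigma s \<epsilon> \<sigma>)) \<and>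
    (\<forall>g h. \<forall>x\<in>gga_component g. \<forall>y\<in>gga_component h.
      gga_mult (scaled_sigma s \<epsilon> \<sigma>) x y = gga_scale s (\<epsilon> g h) (gga_mult \<sigma> x y))"
  proof (intro conjI allI ballI)
    show "bilinear_map (gga_scale s) (gga_mult (scaled_sigma s \<epsilon> \<sigma>))"
      by (rule bilinear_map_gga_mult[OF vs bil'])
    have sc: "scaled_sigma s \<epsilon> \<sigma> g h v w = s (\<epsilon> g h) (\<sigma> g h v w)" for g h v w
      by (simp add: scaled_sigma_def)
    show "gga_mult (scaled_sigma s \<epsilon> \<sigma>) x y = gga_scale s (\<epsilon> g h) (gga_mult \<sigma> x y)"
      if "x \<in> gga_component g" "y \<in> gga_component h" for g h x y
      using that by (auto simp: gga_component_def gga_mult_single[OF bil]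
          gga_mult_single[OF bil'] gga_scale_single[OF vs] sc)
  qed
qed

theorem lemma3p8:
  fixes scale :: "'f::field \<Rightarrow> 'v::ab_group_add \<Rightarrow> 'v"
    and \<sigma> :: "'g::ab_group_add \<Rightarrow> 'g \<Rightarrow> 'v \<Rightarrow> 'v \<Rightarrow> 'v"
    and \<epsilon> :: "'g \<Rightarrow> 'g \<Rightarrow> 'f"
  assumes "vector_space scale"
    and "lie_algebra_over scale \<sigma>"
    and "graded_contraction (gga_scale scale) (gga_mult \<sigma>) gga_component \<epsilon>"
  shows "is_grading (gga_scale scale) (gga_mult \<sigma>) gga_component \<and>
         contracted_bracket (gga_scale scale) (gga_mult \<sigma>) gga_component \<epsilon>
           = gga_mult (scaled_sigma scale \<epsilon> \<sigma>) \<and>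
         lie_algebra_over scale (scaled_sigma scale \<epsilon> \<sigma>)"
proof -
  have bil: "bilinear_map scale (\<sigma> g h)" for g h
    using assms(2) by (simp add: lie_algebra_over_def)
  have eq: "contracted_bracket (gga_scale scale) (gga_mult \<sigma>) gga_component \<epsilon> =
      gga_mult (scaled_sigma scale \<epsilon> \<sigma>)"
    by (rule contracted_bracket_gga_mult[OF assms(1) bil])
  have gr: "is_grading (gga_scale scale) (gga_mult \<sigma>) gga_component"
    by (rule is_grading_gga_component[OF assms(1) bil])
  have "bilinear_map scale (scaled_sigma scale \<epsilon> \<sigma> g h)" for g h
    by (rule bilinear_map_scaled_sigma[OF assms(1) bil])
  \<comment> \<open>Rewriting with \<open>eq\<close> turns the contraction hypothesis into the Lie
    algebra property of the new product.\<close>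
  then have "lie_algebra_over scale (scaled_sigma scale \<epsilon> \<sigma>)"
    using assms(3)
    by (simp add: lie_algebra_over_def graded_contraction_def eq)
  with gr eq show ?thesis by blast
qed

end
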